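(* Let $\mathsf{Q}=(\mathsf{Q},\&)$ be a commutative and unital quantale, let $X$ be a $\mathsf{Q}$-topological space and let $(A,\otimes)$ be a $\mathsf{Q}$-module. Let $\eta_X\colon X\to\mathrm{pt}\,\mathcal{O}(X)$ be the map $\eta_X(x)(\lambda)=\lambda(x)$. (i) $X$ is a $T_0$ space if, and only if, $\eta_X$ is injective. (ii) $X$ is sober if, and only if, $\eta_X$ is bijective; in this case $\eta_X$ is a homeomorphism. (iii) The $\mathsf{Q}$-topological space $\mathrm{pt}A$ is sober. In particular, the space $\mathrm{pt}\,\mathcal{O}(X)$ is sober.
   Context: A commutative unital quantale $(\mathsf{Q},\&)$ is a complete lattice $\mathsf{Q}$ (bottom $0$, top $1$) with a commutative associative operation $\&$ that distributes over arbitrary joins and has a unit $k$ (not necessarily $k=1$). A $\mathsf{Q}$-module is a pair $(A,\otimes)$ with $A$ a complete lattice and $\otimes\colon\mathsf{Q}\times A\to A$ such that $k\otimes x=x$, $s\otimes(r\otimes x)=(s\& r)\otimes x$, and $\otimes$ preserves arbitrary joins in each variable separately. A $\mathsf{Q}$-topology on a set $X$ is a subset of $\mathsf{Q}^X$ containing the constant map $1_X$ with value $1$ and closed under binary meets, arbitrary joins and $\lambda\mapsto\lambda\& r$ for each $r\in\mathsf{Q}$ (all pointwise); its elements are called open sets, and the set of open sets of $X$ is denoted $\mathcal{O}(X)$. It is a $\mathsf{Q}$-module with action $r\otimes\lambda=\lambda\& r$. A map $f\colon X\to Y$ is continuous if $\lambda\circ f\in\mathcal{O}(X)$ for all $\lambda\in\mathcal{O}(Y)$;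 a homeomorphism is a continuous bijection with continuous inverse. $X$ is $T_0$ if for any two distinct points $x,y$ there is an open set $\lambda$ with $\lambda(x)\ne\lambda(y)$. A point of a $\mathsf{Q}$-module $(A,\otimes)$ is a map $p\colon A\to\mathsf{Q}$ with $p(\top)=1$ ($\top$ the top of $A$), $p(\lambda\wedge\mu)=p(\lambda)\wedge p(\mu)$, $p(\bigvee_i\lambda_i)=\bigvee_ip(\lambda_i)$ and $p(r\otimes\lambda)=r\& p(\lambda)$. $\mathrm{pt}A$ is the set of all points of $A$ equipped with the $\mathsf{Q}$-topology $\widehat{A}=\{\widehat{\lambda}\mid\lambda\in A\}$, where $\widehat{\lambda}(p)=p(\lambda)$. $X$ is sober if for each point $p$ of the $\mathsf{Q}$-module $\mathcal{O}(X)$ there is a unique $x\in X$ with $p(\lambda)=\lambda(x)$ for all $\lambda\in\mathcal{O}(X)$. *)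

theory Defs
  imports "HOL-Algebra.Complete_Lattice"
begin

text \<open>
  The multiplication \<open>*\<close> of the class is the quantale multiplication, so the class constant
  \<open>1\<close> is the unit \<open>k\<close> of the quantale and not its top element, which is \<open>top\<close>; the two
  need not coincide. The theory \<open>HOL-Algebra.Lattice\<close> hides the lattice operations of the type
  class hierarchy, which are therefore written \<open>inf_class.inf\<close> and \<open>top_class.top\<close>.
\<close>

class comm_unital_quantale = Complete_Lattices.complete_lattice + comm_monoid_mult +
  assumes mult_Sup_distrib: "a * Sup B = (SUP b\<in>B. a * b)"


record ('a, 'q) q_module = "'a gorder" +
  act :: "'q \<Rightarrow> 'a \<Rightarrow> 'a" (infixr \<open>\<otimes>\<index>\<close> 70)

locale q_module = complete_lattice A
  for A :: "('a, 'q::comm_unital_quantale) q_module" (structure) +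
  assumes act_closed: "x \<in> carrier A \<Longrightarrow> r \<otimes> x \<in> carrier A"
    and act_unit: "x \<in> carrier A \<Longrightarrow> 1 \<otimes> x = x"
    and act_assoc: "x \<in> carrier A \<Longrightarrow> s \<otimes> (r \<otimes> x) = (s * r) \<otimes> x"
    and act_Sup_left: "x \<in> carrier A \<Longrightarrow> Sup R \<otimes> x = \<Squnion>((\<lambda>r. r \<otimes> x) ` R)"
    and act_Sup_right: "S \<subseteq> carrier A \<Longrightarrow> r \<otimes> \<Squnion>S = \<Squnion>((\<lambda>x. r \<otimes> x) ` S)"


text \<open>
  A \<open>Q\<close>-valued map on the set \<open>X\<close> is represented by a function that is \<open>undefined\<close> off \<open>X\<close>, so
  that equality of functions is equality of maps on \<open>X\<close>. The set \<open>X\<close> may be empty.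
\<close>

record ('x, 'q) q_space = "'x partial_object" +
  opens :: "('x \<Rightarrow> 'q) set"

definition q_topological_space :: "('x, 'q::comm_unital_quantale) q_space \<Rightarrow> bool" where
  "q_topological_space X \<longleftrightarrow>
     opens X \<subseteq> extensional (carrier X) \<and>
     (\<lambda>x\<in>carrier X. top_class.top) \<in> opens X \<and>
     (\<forall>l\<in>opens X. \<forall>m\<in>opens X. (\<lambda>x\<in>carrier X. inf_class.inf (l x) (m x)) \<in> opens X) \<and>
     (\<forall>S. S \<subseteq> opens X \<longrightarrow> (\<lambda>x\<in>carrier X. SUP l\<in>S. l x) \<in> opens X) \<and>
     (\<forall>r. \<forall>l\<in>opens X. (\<lambda>x\<in>carrier X. l x * r) \<in> opens X)"

definition opens_module :: "('x, 'q::comm_unital_quantale) q_space \<Rightarrow> ('x \<Rightarrow> 'q, 'q) q_module"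
    (\<open>\<O>\<close>) where
  "\<O> X = \<lparr>carrier = opens X, eq = (=), le = (\<lambda>l m. \<forall>x\<in>carrier X. l x \<le> m x),
           act = (\<lambda>r l. \<lambda>x\<in>carrier X. l x * r)\<rparr>"

definition q_continuous ::
    "('x, 'q::comm_unital_quantale) q_space \<Rightarrow> ('y, 'q) q_space \<Rightarrow> ('x \<Rightarrow> 'y) \<Rightarrow> bool" where
  "q_continuous X Y f \<longleftrightarrow>
     f \<in> carrier X \<rightarrow> carrier Y \<and> (\<forall>l\<in>opens Y. compose (carrier X) l f \<in> opens X)"

definition q_homeomorphism ::
    "('x, 'q::comm_unital_quantale) q_space \<Rightarrow> ('y, 'q) q_space \<Rightarrow> ('x \<Rightarrow> 'y) \<Rightarrow> bool" where
  "q_homeomorphism X Y f \<longleftrightarrow>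
     q_continuous X Y f \<and> bij_betw f (carrier X) (carrier Y) \<and>
     q_continuous Y X (inv_into (carrier X) f)"

definition q_T0 :: "('x, 'q::comm_unital_quantale) q_space \<Rightarrow> bool" where
  "q_T0 X \<longleftrightarrow>
     (\<forall>x\<in>carrier X. \<forall>y\<in>carrier X. x \<noteq> y \<longrightarrow> (\<exists>l\<in>opens X. l x \<noteq> l y))"


definition points :: "('a, 'q::comm_unital_quantale) q_module \<Rightarrow> ('a \<Rightarrow> 'q) set" where
  "points A = {p \<in> extensional (carrier A).
     p \<top>\<^bsub>A\<^esub> = top_class.top \<and>
     (\<forall>l\<in>carrier A. \<forall>m\<in>carrier A. p (l \<sqinter>\<^bsub>A\<^esub> m) = inf_class.inf (p l) (p m)) \<and>
     (\<forall>S. S \<subseteq> carrier A \<longrightarrow> p (\<Squnion>\<^bsub>A\<^esub>S) = (SUP l\<in>S. p l)) \<and>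
     (\<forall>r. \<forall>l\<in>carrier A. p (r \<otimes>\<^bsub>A\<^esub> l) = r * p l)}"

definition pt :: "('a, 'q::comm_unital_quantale) q_module \<Rightarrow> ('a \<Rightarrow> 'q, 'q) q_space" where
  "pt A = \<lparr>carrier = points A, opens = (\<lambda>l. \<lambda>p\<in>points A. p l) ` carrier A\<rparr>"

definition q_sober :: "('x, 'q::comm_unital_quantale) q_space \<Rightarrow> bool" where
  "q_sober X \<longleftrightarrow>
     (\<forall>p\<in>points (\<O> X). \<exists>!x. x \<in> carrier X \<and> (\<forall>l\<in>opens X. p l = l x))"

definition eta :: "('x, 'q::comm_unital_quantale) q_space \<Rightarrow> 'x \<Rightarrow> ('x \<Rightarrow> 'q) \<Rightarrow> 'q"
    (\<open>\<eta>\<close>) where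
  "\<eta> X x = (\<lambda>l\<in>opens X. l x)"


text \<open>Well-definedness: \<open>\<O> X\<close> is a module with pointwise joins and meets, \<open>pt A\<close> is a space, \<open>\<eta> X\<close> maps into it.\<close>

lemma opens_module_sel [simp]:
  "carrier (\<O> X) = opens X" "eq (\<O> X) = (=)"
  "le (\<O> X) l m \<longleftrightarrow> (\<forall>x\<in>carrier X. l x \<le> m x)"
  "act (\<O> X) r l = (\<lambda>x\<in>carrier X. l x * r)"
  by (simp_all add: opens_module_def)

lemma opens_eqI:
  assumes "q_topological_space X" "l \<in> opens X" "m \<in> opens X"
    and "\<And>x. x \<in> carrier X \<Longrightarrow> l x = m x"
  shows "l = m"
  using assms unfolding q_topological_space_def by (meson extensionalityI subsetD)

lemma opens_module_least:
  assumes X: "q_topological_space X" and S: "S \<subseteq> opens X"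
  shows "least (\<O> X) (\<lambda>x\<in>carrier X. SUP l\<in>S. l x) (Upper (\<O> X) S)"
  using assms unfolding least_def Upper_def q_topological_space_def
  by (auto intro!: SUP_upper SUP_least)

lemma opens_module_complete:
  assumes X: "q_topological_space X"
  shows "complete_lattice (\<O> X)"
proof -
  interpret partial_order "\<O> X"
    by standard (auto intro: order_trans, metis opens_eqI [OF X] order_antisym)
  show ?thesis
  proof (rule complete_latticeI)
    fix S assume S: "S \<subseteq> carrier (\<O> X)"
    then show "\<exists>s. least (\<O> X) s (Upper (\<O> X) S)"
      using opens_module_least [OF X] by auto
    let ?L = "Lower (\<O> X) S"
    have L: "?L \<subseteq> opens X"
      by (auto simp: Lower_def)
    have "greatest (\<O> X) (\<lambda>x\<in>carrier X. SUP l\<in>?L. l x) ?L"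
      using X L S unfolding greatest_def q_topological_space_def
      by (auto intro!: SUP_upper SUP_least simp: Lower_def)
    then show "\<exists>i. greatest (\<O> X) i ?L"
      by (intro exI)
  qed
qed

lemma opens_module_Sup:
  assumes X: "q_topological_space X" and S: "S \<subseteq> opens X"
  shows "\<Squnion>\<^bsub>\<O> X\<^esub>S = (\<lambda>x\<in>carrier X. SUP l\<in>S. l x)"
proof -
  interpret complete_lattice "\<O> X" by (rule opens_module_complete [OF X])
  show ?thesis
    using least_unique [OF sup_lub opens_module_least [OF X S]] S by simp
qed

lemma opens_module_meet:
  assumes X: "q_topological_space X" and "l \<in> opens X" "m \<in> opens X"
  shows "l \<sqinter>\<^bsub>\<O> X\<^esub> m = (\<lambda>x\<in>carrier X. inf_class.inf (l x) (m x))"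
proof -
  interpret complete_lattice "\<O> X" by (rule opens_module_complete [OF X])
  have "greatest (\<O> X) (\<lambda>x\<in>carrier X. inf_class.inf (l x) (m x)) (Lower (\<O> X) {l, m})"
    using assms unfolding greatest_def Lower_def q_topological_space_def by auto
  moreover have "greatest (\<O> X) (l \<sqinter>\<^bsub>\<O> X\<^esub> m) (Lower (\<O> X) {l, m})"
    using assms by (simp add: meet_def inf_glb)
  ultimately show ?thesis
    by (rule greatest_unique [rotated])
qed

lemma opens_module_top:
  assumes X: "q_topological_space X"
  shows "\<top>\<^bsub>\<O> X\<^esub> = (\<lambda>x\<in>carrier X. top_class.top)"
proof -
  interpret complete_lattice "\<O> X" by (rule opens_module_complete [OF X])
  have "greatest (\<O> X) (\<lambda>x\<in>carrier X. top_class.top) (carrier (\<O> X))"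
    using X unfolding greatest_def q_topological_space_def by auto
  from greatest_unique [OF top_greatest this] show ?thesis .
qed

lemma opens_module_q_module:
  assumes X: "q_topological_space X"
  shows "q_module (\<O> X)"
proof -
  interpret complete_lattice "\<O> X" by (rule opens_module_complete [OF X])
  have act: "(\<lambda>x\<in>carrier X. l x * r) \<in> opens X" if "l \<in> opens X" for l r
    using X that unfolding q_topological_space_def by blast
  have act': "(\<lambda>x\<in>carrier X. r * l x) \<in> opens X" if "l \<in> opens X" for l r
    using act [OF that, of r] by (simp add: mult.commute)
  show ?thesis
  proof
    fix l r s R and S :: "('a \<Rightarrow> 'b) set"
    show "S \<subseteq> carrier (\<O> X) \<Longrightarrow>
        r \<otimes>\<^bsub>\<O> X\<^esub> \<Squnion>\<^bsub>\<O> X\<^esub>S = \<Squnion>\<^bsub>\<O> X\<^esub>((\<lambda>l. r \<otimes>\<^bsub>\<O> X\<^esub> l) ` S)"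
      using act act' by (subst (1 2) opens_module_Sup [OF X])
        (auto simp: mult_Sup_distrib image_image mult.commute [of _ r] intro!: restrict_ext)
    assume l: "l \<in> carrier (\<O> X)"
    show "r \<otimes>\<^bsub>\<O> X\<^esub> l \<in> carrier (\<O> X)"
      using act l by simp
    show "1 \<otimes>\<^bsub>\<O> X\<^esub> l = l"
      using act [of l 1] l by (auto intro: opens_eqI [OF X])
    show "s \<otimes>\<^bsub>\<O> X\<^esub> (r \<otimes>\<^bsub>\<O> X\<^esub> l) = (s * r) \<otimes>\<^bsub>\<O> X\<^esub> l"
      by (auto simp: mult_ac)
    show "Sup R \<otimes>\<^bsub>\<O> X\<^esub> l = \<Squnion>\<^bsub>\<O> X\<^esub>((\<lambda>r. r \<otimes>\<^bsub>\<O> X\<^esub> l) ` R)"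
      using act l by (subst opens_module_Sup [OF X])
        (auto simp: mult_Sup_distrib image_image intro!: restrict_ext)
  qed
qed

lemma pt_q_topological_space:
  assumes "q_module A"
  shows "q_topological_space (pt A)"
proof -
  interpret q_module A by fact
  let ?h = "\<lambda>l. \<lambda>p\<in>points A. p l"
  have "(\<lambda>p\<in>points A. SUP l\<in>S. l p) \<in> ?h ` carrier A" if S: "S \<subseteq> ?h ` carrier A" for S
  proof -
    obtain T where T: "T \<subseteq> carrier A" "S = ?h ` T"
      using S by (auto simp: subset_image_iff)
    have "(\<lambda>p\<in>points A. SUP l\<in>S. l p) = ?h (\<Squnion>\<^bsub>A\<^esub>T)"
      using T by (auto simp: points_def image_image intro!: restrict_ext)
    then show ?thesis
      using T by simp
  qed
  moreover have "(\<lambda>p\<in>points A. top_class.top) = ?h \<top>\<^bsub>A\<^esub>"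
    by (auto simp: points_def intro!: restrict_ext)
  moreover have "(\<lambda>p\<in>points A. inf_class.inf (?h l p) (?h m p)) = ?h (l \<sqinter>\<^bsub>A\<^esub> m)"
    if "l \<in> carrier A" "m \<in> carrier A" for l m
    using that by (auto simp: points_def intro!: restrict_ext)
  moreover have "(\<lambda>p\<in>points A. ?h l p * r) = ?h (r \<otimes>\<^bsub>A\<^esub> l)" if "l \<in> carrier A" for l r
    using that by (auto simp: points_def mult.commute intro!: restrict_ext)
  ultimately show ?thesis
    unfolding q_topological_space_def pt_def
    by (auto simp: act_closed simp del: restrict_apply)
qed

lemma eta_in_pt:
  assumes X: "q_topological_space X"
  shows "\<eta> X \<in> carrier X \<rightarrow> carrier (pt (\<O> X))"
  using X
  by (auto simp: pt_def points_def eta_def opens_module_top opens_module_meet opens_module_Sup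
      q_topological_space_def mult.commute subset_iff intro!: SUP_cong)

end

theory Submission
  imports Defs
begin

text \<open>
  The map \<open>\<eta> X\<close> is built so that two facts hold tautologically. First, \<open>\<eta> X x = \<eta> X y\<close> means that
  no open set distinguishes \<open>x\<close> from \<open>y\<close> (\<open>eta_eq_iff\<close>), so injectivity is the \<open>T\<^sub>0\<close> axiom.
  Secondly, a point \<open>p\<close> of \<open>\<O> X\<close> equals \<open>\<eta> X x\<close> exactly if \<open>p\<close> is evaluation at \<open>x\<close>
  (\<open>point_eq_eta_iff\<close>), so the unique existence of such an \<open>x\<close> for each \<open>p\<close> is bijectivity.
  Moreover, pulling back \<open>hat (\<O> X) l\<close> along \<open>\<eta> X\<close> returns \<open>l\<close> itself (\<open>compose_hat_eta\<close>). Hence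
  \<open>\<eta> X\<close> is continuous, and every open set of \<open>X\<close> is such a pullback, so the inverse of \<open>\<eta> X\<close>, when
  it exists, is continuous too.

  Sobriety of \<open>pt A\<close> rests on the fact that \<open>hat A\<close> is a surjective homomorphism from \<open>A\<close> onto
  \<open>\<O> (pt A)\<close> preserving the top, binary meets, joins and the action. A point \<open>P\<close> of \<open>\<O> (pt A)\<close>
  therefore pulls back along \<open>hat A\<close> to a point \<open>p\<close> of \<open>A\<close> (\<open>point_pullback_hat\<close>), and
  \<open>P (hat A l) = p l = hat A l p\<close> says that \<open>P\<close> is evaluation at \<open>p\<close>. Because the open sets of
  \<open>pt A\<close> already recover all values of a point, no other point of \<open>A\<close> will do.
\<close>

definition hat :: "('a, 'q::comm_unital_quantale) q_module \<Rightarrow> 'a \<Rightarrow> ('a \<Rightarrow> 'q) \<Rightarrow> 'q" where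
  "hat A l = (\<lambda>p\<in>points A. p l)"

lemma carrier_pt [simp]: "carrier (pt A) = points A"
  by (simp add: pt_def)

lemma opens_pt: "opens (pt A) = hat A ` carrier A"
  by (simp add: pt_def hat_def [abs_def])

lemma hat_apply [simp]: "p \<in> points A \<Longrightarrow> hat A l p = p l"
  by (simp add: hat_def)

lemma points_eqI:
  assumes "p \<in> points A" "q \<in> points A" "\<And>l. l \<in> carrier A \<Longrightarrow> p l = q l"
  shows "p = q"
  using assms by (auto simp: points_def intro: extensionalityI)

lemma eta_eq_iff: "\<eta> X x = \<eta> X y \<longleftrightarrow> (\<forall>l\<in>opens X. l x = l y)"
  by (auto simp: eta_def restrict_def fun_eq_iff)

lemma eta_in_points:
  assumes "q_topological_space X" "x \<in> carrier X"
  shows "\<eta> X x \<in> points (\<O> X)"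
  using eta_in_pt [OF assms(1)] assms(2) by (auto simp: Pi_iff)

lemma point_eq_eta_iff:
  assumes "p \<in> points (\<O> X)"
  shows "p = \<eta> X x \<longleftrightarrow> (\<forall>l\<in>opens X. p l = l x)"
  using assms by (auto simp: points_def eta_def intro!: extensionalityI [of p "opens X"])

lemma q_T0_iff_inj_eta: "q_T0 X \<longleftrightarrow> inj_on (\<eta> X) (carrier X)"
  unfolding q_T0_def inj_on_def eta_eq_iff by blast

lemma q_sober_iff_bij_eta:
  assumes "q_topological_space X"
  shows "q_sober X \<longleftrightarrow> bij_betw (\<eta> X) (carrier X) (points (\<O> X))"
proof -
  have "q_sober X \<longleftrightarrow> (\<forall>p\<in>points (\<O> X). \<exists>!x. x \<in> carrier X \<and> p = \<eta> X x)"
    unfolding q_sober_def by (simp add: point_eq_eta_iff cong: ball_cong)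
  also have "\<dots> \<longleftrightarrow> bij_betw (\<eta> X) (carrier X) (points (\<O> X))"
    using eta_in_points [OF assms] unfolding bij_betw_def inj_on_def by blast
  finally show ?thesis .
qed

lemma compose_hat_eta:
  assumes X: "q_topological_space X" and l: "l \<in> opens X"
  shows "compose (carrier X) (hat (\<O> X) l) (\<eta> X) = l"
proof (rule extensionalityI [of _ "carrier X"])
  show "l \<in> extensional (carrier X)"
    using X l by (auto simp: q_topological_space_def)
qed (use eta_in_points [OF X] l in \<open>auto simp: compose_def eta_def\<close>)

lemma q_continuous_eta:
  assumes X: "q_topological_space X"
  shows "q_continuous X (pt (\<O> X)) (\<eta> X)"
  using eta_in_pt [OF X] compose_hat_eta [OF X] by (auto simp: q_continuous_def opens_pt)

text \<open>
  Since each open set \<open>l\<close> of \<open>X\<close> is the pullback of \<open>hat (\<O> X) l\<close> along \<open>\<eta> X\<close>, its pullback along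
  the inverse of \<open>\<eta> X\<close> is \<open>hat (\<O> X) l\<close> again, which is open.
\<close>

lemma q_homeomorphism_eta:
  assumes X: "q_topological_space X"
    and bij: "bij_betw (\<eta> X) (carrier X) (points (\<O> X))"
  shows "q_homeomorphism X (pt (\<O> X)) (\<eta> X)"
proof -
  let ?g = "inv_into (carrier X) (\<eta> X)"
  have g: "?g p \<in> carrier X" "\<eta> X (?g p) = p" if "p \<in> points (\<O> X)" for p
    using that bij_betw_imp_surj_on [OF bij] by (auto intro: inv_into_into f_inv_into_f)
  have "compose (points (\<O> X)) l ?g = hat (\<O> X) l" if l: "l \<in> opens X" for l
  proof (unfold compose_def hat_def, rule restrict_ext)
    fix p assume p: "p \<in> points (\<O> X)"
    have "l (?g p) = \<eta> X (?g p) l"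
      using l by (simp add: eta_def)
    then show "l (?g p) = p l"
      using g [OF p] by simp
  qed
  then have "q_continuous (pt (\<O> X)) X ?g"
    using g by (auto simp: q_continuous_def opens_pt)
  then show ?thesis
    using q_continuous_eta [OF X] bij by (simp add: q_homeomorphism_def)
qed

text \<open>
  Points of \<open>A\<close> preserve the top, meets, joins and the action of \<open>A\<close>, while these operations are
  pointwise in \<open>\<O> (pt A)\<close>; this makes \<open>hat A\<close> a homomorphism.
\<close>

lemma hat_top:
  assumes "q_module A"
  shows "hat A \<top>\<^bsub>A\<^esub> = \<top>\<^bsub>\<O> (pt A)\<^esub>"
  unfolding opens_module_top [OF pt_q_topological_space [OF assms]]
  by (auto simp: hat_def points_def intro!: restrict_ext)

lemma hat_meet:
  assumes "q_module A" "l \<in> carrier A" "m \<in> carrier A"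
  shows "hat A (l \<sqinter>\<^bsub>A\<^esub> m) = hat A l \<sqinter>\<^bsub>\<O> (pt A)\<^esub> hat A m"
  using assms
  by (subst opens_module_meet [OF pt_q_topological_space])
    (auto simp: opens_pt hat_def points_def intro!: restrict_ext)

lemma hat_Sup:
  assumes "q_module A" "S \<subseteq> carrier A"
  shows "hat A (\<Squnion>\<^bsub>A\<^esub>S) = \<Squnion>\<^bsub>\<O> (pt A)\<^esub>(hat A ` S)"
  using assms
  by (subst opens_module_Sup [OF pt_q_topological_space])
    (auto simp: opens_pt hat_def points_def image_image intro!: restrict_ext)

lemma hat_act:
  assumes "l \<in> carrier A"
  shows "hat A (r \<otimes>\<^bsub>A\<^esub> l) = r \<otimes>\<^bsub>\<O> (pt A)\<^esub> hat A l"
  using assms by (auto simp: hat_def points_def mult.commute intro!: restrict_ext)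

text \<open>
  A point is a homomorphism into the quantale, so its composite with the homomorphism \<open>hat A\<close>
  is one as well. This provides the only candidate for a point of \<open>A\<close> at which \<open>P\<close> is evaluation.
\<close>

lemma point_pullback_hat:
  assumes A: "q_module A" and P: "P \<in> points (\<O> (pt A))"
  shows "(\<lambda>l\<in>carrier A. P (hat A l)) \<in> points A"
proof -
  interpret q_module A by (rule A)
  have hat_open: "hat A l \<in> opens (pt A)" if "l \<in> carrier A" for l
    using that by (simp add: opens_pt)
  have P_top: "P \<top>\<^bsub>\<O> (pt A)\<^esub> = top_class.top"
    and P_meet: "\<And>l m. l \<in> opens (pt A) \<Longrightarrow> m \<in> opens (pt A) \<Longrightarrow>
      P (l \<sqinter>\<^bsub>\<O> (pt A)\<^esub> m) = inf_class.inf (P l) (P m)"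
    and P_Sup: "\<And>S. S \<subseteq> opens (pt A) \<Longrightarrow> P (\<Squnion>\<^bsub>\<O> (pt A)\<^esub>S) = (SUP l\<in>S. P l)"
    and P_act: "\<And>r l. l \<in> opens (pt A) \<Longrightarrow> P (r \<otimes>\<^bsub>\<O> (pt A)\<^esub> l) = r * P l"
    using P by (simp_all only: points_def opens_module_sel(1) mem_Collect_eq)
  let ?p = "\<lambda>l\<in>carrier A. P (hat A l)"
  have "?p \<top>\<^bsub>A\<^esub> = top_class.top"
    by (simp add: hat_top [OF A] P_top)
  moreover have "?p (l \<sqinter>\<^bsub>A\<^esub> m) = inf_class.inf (?p l) (?p m)"
    if "l \<in> carrier A" "m \<in> carrier A" for l m
    using that by (simp add: hat_meet [OF A] P_meet hat_open)
  moreover have "?p (\<Squnion>\<^bsub>A\<^esub>S) = (SUP l\<in>S. ?p l)" if S: "S \<subseteq> carrier A" for S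
  proof -
    have "hat A ` S \<subseteq> opens (pt A)"
      using S by (auto simp: opens_pt)
    then have "?p (\<Squnion>\<^bsub>A\<^esub>S) = (SUP l\<in>S. P (hat A l))"
      using S by (simp add: hat_Sup [OF A] P_Sup image_image)
    also have "\<dots> = (SUP l\<in>S. ?p l)"
      using S by (intro SUP_cong) auto
    finally show ?thesis .
  qed
  moreover have "?p (r \<otimes>\<^bsub>A\<^esub> l) = r * ?p l" if "l \<in> carrier A" for r l
    using that by (simp add: act_closed hat_act P_act hat_open del: opens_module_sel(4))
  ultimately show ?thesis
    unfolding points_def by (simp del: restrict_apply)
qed

lemma q_sober_pt:
  assumes A: "q_module A"
  shows "q_sober (pt A)"
  unfolding q_sober_def
proof
  fix P assume P: "P \<in> points (\<O> (pt A))"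
  let ?p = "\<lambda>l\<in>carrier A. P (hat A l)"
  have p: "?p \<in> points A"
    by (rule point_pullback_hat [OF A P])
  show "\<exists>!x. x \<in> carrier (pt A) \<and> (\<forall>l\<in>opens (pt A). P l = l x)"
  proof (rule ex1I [of _ ?p])
    show "?p \<in> carrier (pt A) \<and> (\<forall>l\<in>opens (pt A). P l = l ?p)"
      using p by (auto simp: opens_pt)
  next
    fix q assume "q \<in> carrier (pt A) \<and> (\<forall>l\<in>opens (pt A). P l = l q)"
    then show "q = ?p"
      using p by (intro points_eqI [of q A]) (auto simp: opens_pt)
  qed
qed

theorem proposition3p5:
  fixes X :: "('x, 'q::comm_unital_quantale) q_space"
    and A :: "('a, 'q) q_module"
  assumes "q_topological_space X" and "q_module A"
  shows "(q_T0 X \<longleftrightarrow> inj_on (\<eta> X) (carrier X)) \<and>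
    (q_sober X \<longleftrightarrow> bij_betw (\<eta> X) (carrier X) (carrier (pt (\<O> X)))) \<and>
    (q_sober X \<longrightarrow> q_homeomorphism X (pt (\<O> X)) (\<eta> X)) \<and>
    q_topological_space (pt A) \<and> q_sober (pt A) \<and>
    q_topological_space (pt (\<O> X)) \<and> q_sober (pt (\<O> X))"
proof (intro conjI impI)
  show "q_T0 X \<longleftrightarrow> inj_on (\<eta> X) (carrier X)"
    by (rule q_T0_iff_inj_eta)
  show sober_iff: "q_sober X \<longleftrightarrow> bij_betw (\<eta> X) (carrier X) (carrier (pt (\<O> X)))"
    unfolding carrier_pt by (rule q_sober_iff_bij_eta [OF assms(1)])
  show "q_homeomorphism X (pt (\<O> X)) (\<eta> X)" if "q_sober X"
    using that sober_iff unfolding carrier_pt by (intro q_homeomorphism_eta [OF assms(1)]) simp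
  show "q_topological_space (pt A)" "q_sober (pt A)"
    by (rule pt_q_topological_space q_sober_pt, rule assms)+
  show "q_topological_space (pt (\<O> X))" "q_sober (pt (\<O> X))"
    by (rule pt_q_topological_space q_sober_pt, rule opens_module_q_module, rule assms)+
qed

end
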